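(* Let $I\subset (R,w)$ be a homogeneous ideal generated in degrees $\leq d$ and let $q=\operatorname{lcm}(q_1,\ldots,q_n)$. If $I_i$ is spanned (as a $K$-vector space) by a lexsegment for all $i\leq d+q+G(w)$, then $I$ is a lexicographic ideal.
   Context: Setting: $K$ is an infinite field of characteristic $0$ and $R=K[\mathbf{X_1},\ldots,\mathbf{X_n}]$ is a polynomial ring in the groups of variables $\mathbf{X_i}=(X_{i1},\ldots,X_{il_i})$, graded by $\deg X_{ij}=q_i$ for $j=1,\ldots,l_i$, where $0<q_1<q_2<\cdots<q_n$ are integers. $l=\sum_i l_i$ is the total number of variables and $w=(w_1,\ldots,w_l)=(\deg X_{11},\ldots,\deg X_{nl_n})$ is the weight vector; $(R,w)$ is $R$ with this grading. Lexicographic order and ideals: monomials of the same (weighted) degree are compared lexicographically with the variables listed as $X_{11},\ldots,X_{1l_1},X_{21},\ldots,X_{nl_n}$ (for $u\neq v$ of the same degree, $u>v$ iff the first nonzero entry of the exponent vector of $u$ minus that of $v$ is positive). A lexsegment of degree $i$ is a (possibly empty) set $L$ of monomials of degree $i$ such that $u\in L$, $v>u$, $\deg v=\deg u$ imply $v\in L$. A homogeneous monomial ideal is lexicographic if each of its graded components is spanned as a $K$-vector space by a lexsegment. The invariant $G(w)$ (Delorme): if $l=1$, $G(w)=-w_1$; if $l\ge2$, put $r=l-1$ and $$G(w)=-\sum_{i=1}^{l}w_i+\frac1r\sum_{\nu=2}^{r+1}\binom{r-1}{\nu-2}^{-1}\sum_{J\subseteq\{1,\ldots,l\},\,|J|=\nu}\operatorname{lcm}(w_j: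 j\in J).$$ Known property of $G(w)$ (recalled by the paper from the literature): if $m>G(w)$ is an integer, then for any $h\in\mathbb N$ every monomial of $R_{m+hq}$ is divisible by a monomial in $R_{hq}$. *)

theory Defs
  imports Complex_Main "HOL-Algebra.Ideal" "HOL-Library.Poly_Mapping"
    "HOL-Library.Product_Lexorder"
begin

text \<open>A monomial is its exponent vector, and a polynomial is the finitely supported family of
  its coefficients; multiplication of polynomials is the convolution product of
  \<^theory>\<open>HOL-Library.Poly_Mapping\<close>. Below, \<open>V\<close> is the set of variables and
  \<open>w\<close> gives the degree of each variable.\<close>

type_synonym 'v monomial = "'v \<Rightarrow>\<^sub>0 nat"
type_synonym ('v, 'k) mpoly = "'v monomial \<Rightarrow>\<^sub>0 'k"

definition monomials :: "'v set \<Rightarrow> 'v monomial set" where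
  "monomials V = {u. Poly_Mapping.keys u \<subseteq> V}"

definition poly_of_monomial :: "'v monomial \<Rightarrow> ('v, 'k::field_char_0) mpoly" where
  "poly_of_monomial u = Poly_Mapping.single u 1"

definition poly_ring :: "'v set \<Rightarrow> ('v, 'k::field_char_0) mpoly ring" where
  "poly_ring V = \<lparr>carrier = {f. Poly_Mapping.keys f \<subseteq> monomials V},
     mult = (*), one = 1, zero = 0, add = (+)\<rparr>"

definition wdeg :: "('v \<Rightarrow> nat) \<Rightarrow> 'v monomial \<Rightarrow> nat" where
  "wdeg w u = (\<Sum>x\<in>Poly_Mapping.keys u. Poly_Mapping.lookup u x * w x)"

definition homogeneous :: "('v \<Rightarrow> nat) \<Rightarrow> nat \<Rightarrow> ('v, 'k::field_char_0) mpoly \<Rightarrow> bool" where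
  "homogeneous w i f \<longleftrightarrow> (\<forall>u\<in>Poly_Mapping.keys f. wdeg w u = i)"

definition hom_component ::
  "('v \<Rightarrow> nat) \<Rightarrow> nat \<Rightarrow> ('v, 'k::field_char_0) mpoly \<Rightarrow> ('v, 'k) mpoly" where
  "hom_component w i f =
     (\<Sum>u\<in>{u \<in> Poly_Mapping.keys f. wdeg w u = i}. Poly_Mapping.single u (Poly_Mapping.lookup f u))"

definition homogeneous_ideal ::
  "'v set \<Rightarrow> ('v \<Rightarrow> nat) \<Rightarrow> ('v, 'k::field_char_0) mpoly set \<Rightarrow> bool" where
  "homogeneous_ideal V w I \<longleftrightarrow>
     ideal I (poly_ring V) \<and> (\<forall>f\<in>I. \<forall>i. hom_component w i f \<in> I)"

definition generated_in_degrees_le ::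
  "'v set \<Rightarrow> ('v \<Rightarrow> nat) \<Rightarrow> ('v, 'k::field_char_0) mpoly set \<Rightarrow> nat \<Rightarrow> bool" where
  "generated_in_degrees_le V w I d \<longleftrightarrow>
     (\<exists>S \<subseteq> carrier (poly_ring V).
        (\<forall>f\<in>S. \<exists>i\<le>d. homogeneous w i f) \<and> I = genideal (poly_ring V) S)"

definition monomial_ideal :: "'v set \<Rightarrow> ('v, 'k::field_char_0) mpoly set \<Rightarrow> bool" where
  "monomial_ideal V I \<longleftrightarrow>
     (\<exists>M \<subseteq> monomials V. I = genideal (poly_ring V) (poly_of_monomial ` M))"

definition graded_component ::
  "('v \<Rightarrow> nat) \<Rightarrow> ('v, 'k::field_char_0) mpoly set \<Rightarrow> nat \<Rightarrow> ('v, 'k) mpoly set" where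
  "graded_component w I i = {f \<in> I. homogeneous w i f}"

definition scalar_mult :: "'k::field_char_0 \<Rightarrow> ('v, 'k) mpoly \<Rightarrow> ('v, 'k) mpoly" where
  "scalar_mult c f = Poly_Mapping.single 0 c * f"

definition K_span :: "('v, 'k::field_char_0) mpoly set \<Rightarrow> ('v, 'k) mpoly set" where
  "K_span = module.span scalar_mult"

text \<open>The order on exponent vectors provided by \<^theory>\<open>HOL-Library.Poly_Mapping\<close> is the
  lexicographic one: \<open>u < v\<close> iff \<open>u\<close> and \<open>v\<close> differ and \<open>v\<close> has the larger exponent at the
  first variable where they differ (lemma \<open>monomial_less_iff\<close>).\<close>

definition lexsegment ::
  "'v::linorder set \<Rightarrow> ('v \<Rightarrow> nat) \<Rightarrow> nat \<Rightarrow> 'v monomial set \<Rightarrow> bool" where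
  "lexsegment V w i L \<longleftrightarrow>
     L \<subseteq> {u \<in> monomials V. wdeg w u = i} \<and>
     (\<forall>u\<in>L. \<forall>v\<in>monomials V. wdeg w v = wdeg w u \<and> v > u \<longrightarrow> v \<in> L)"

definition spanned_by_lexsegment ::
  "'v::linorder set \<Rightarrow> ('v \<Rightarrow> nat) \<Rightarrow> ('v, 'k::field_char_0) mpoly set \<Rightarrow> nat \<Rightarrow> bool" where
  "spanned_by_lexsegment V w I i \<longleftrightarrow>
     (\<exists>L. lexsegment V w i L \<and> graded_component w I i = K_span (poly_of_monomial ` L))"

definition lexicographic_ideal ::
  "'v::linorder set \<Rightarrow> ('v \<Rightarrow> nat) \<Rightarrow> ('v, 'k::field_char_0) mpoly set \<Rightarrow> bool" where
  "lexicographic_ideal V w I \<longleftrightarrow>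
     homogeneous_ideal V w I \<and> monomial_ideal V I \<and> (\<forall>i. spanned_by_lexsegment V w I i)"

text \<open>Delorme's invariant of the weights \<open>(w x)\<close> for \<open>x \<in> V\<close>. It is symmetric in the weights,
  so they are indexed by the variables themselves rather than by \<open>{1..l}\<close>; for \<open>l = 1\<close> the sum
  in the first branch is the single weight.\<close>

definition delorme_G :: "'v set \<Rightarrow> ('v \<Rightarrow> nat) \<Rightarrow> real" where
  "delorme_G V w =
     (let l = card V; r = l - 1 in
      if l = 1 then - (\<Sum>x\<in>V. real (w x))
      else - (\<Sum>x\<in>V. real (w x))
           + 1 / real r * (\<Sum>\<nu>=2..r+1. inverse (real ((r - 1) choose (\<nu> - 2)))
               * (\<Sum>J\<in>{J. J \<subseteq> V \<and> card J = \<nu>}. real (Lcm (w ` J)))))"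

text \<open>The variable \<open>X\<^sub>i\<^sub>j\<close> is the pair \<open>(i, j)\<close>. The order on pairs is the lexicographic one of
  \<^theory>\<open>HOL-Library.Product_Lexorder\<close>, so the variables are listed as
  \<open>X\<^sub>1\<^sub>1, X\<^sub>1\<^sub>2, \<dots>, X\<^sub>2\<^sub>1, \<dots>\<close>.\<close>

definition grouped_vars :: "nat \<Rightarrow> (nat \<Rightarrow> nat) \<Rightarrow> (nat \<times> nat) set" where
  "grouped_vars n ls = (SIGMA i:{1..n}. {1..ls i})"

definition grouped_weight :: "(nat \<Rightarrow> nat) \<Rightarrow> nat \<times> nat \<Rightarrow> nat" where
  "grouped_weight q x = q (fst x)"

lemma monomial_less_iff:
  fixes u v :: "'v::linorder monomial"
  shows "u < v \<longleftrightarrow> (\<exists>x. Poly_Mapping.lookup u x < Poly_Mapping.lookup v x \<and>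
           (\<forall>y<x. Poly_Mapping.lookup u y = Poly_Mapping.lookup v y))"
  by transfer (simp add: less_fun_def)

lemma monomials_add: "u \<in> monomials V \<Longrightarrow> v \<in> monomials V \<Longrightarrow> u + v \<in> monomials V"
  unfolding monomials_def using Poly_Mapping.keys_add[of u v] by blast

lemma poly_ring_cring: "cring (poly_ring V :: ('v, 'k::field_char_0) mpoly ring)"
proof -
  let ?C = "{f :: ('v, 'k) mpoly. Poly_Mapping.keys f \<subseteq> monomials V}"
  have add: "f + g \<in> ?C" if "f \<in> ?C" "g \<in> ?C" for f g
    using that Poly_Mapping.keys_add[of f g] by blast
  have mult: "f * g \<in> ?C" if "f \<in> ?C" "g \<in> ?C" for f g
    using that keys_mult[of f g] monomials_add by fastforce
  have neg: "- f \<in> ?C" if "f \<in> ?C" for f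
    using that by simp
  have one: "1 \<in> ?C"
    by (simp add: monomials_def)
  show ?thesis
    unfolding poly_ring_def
    by (intro cringI abelian_groupI comm_monoidI)
      (use add mult neg one in \<open>auto simp: algebra_simps intro!: exI[of _ "- _"]\<close>)
qed

lemma scalar_mult_vector_space:
  "vector_space (scalar_mult :: 'k::field_char_0 \<Rightarrow> ('v, 'k) mpoly \<Rightarrow> _)"
  by standard
    (simp_all add: scalar_mult_def algebra_simps single_add mult_single flip: mult.assoc)

end

theory Submission
  imports Defs
begin

text \<open>
  Write \<open>q\<close> for the least common multiple of the weights and \<open>G\<close> for Delorme's invariant. The
  lexsegment property is propagated by strong induction on the degree \<open>i > d + q + G\<close>. Let \<open>u\<close>
  be a monomial of \<open>I\<close> and \<open>v > u\<close> another monomial, both of degree \<open>i\<close>. Since \<open>u = g m\<close> with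
  \<open>g \<in> I\<close> of degree at most \<open>d\<close>, the cofactor \<open>m\<close> has degree above \<open>q + G\<close>, so a divisor
  \<open>a\<close> of \<open>m\<close> of degree \<open>q\<close> can be split off, leaving \<open>u = u' a\<close> with \<open>u' \<in> I\<close>
  (\<open>divisor_of_common_multiple_degree\<close>). Let \<open>x\<close> be the last variable of \<open>v\<close>. Because the
  weight of \<open>x\<close> divides \<open>q\<close>, some power \<open>x^e\<close> also has degree \<open>q\<close>, and then \<open>v \<ge> u' x^e\<close>
  (\<open>add_power_of_last_variable_le\<close>). Cancelling one \<open>x\<close> gives \<open>v / x \<ge> u' x^(e-1) \<in> I\<close> in a
  smaller degree, where the induction hypothesis puts \<open>v / x\<close>, hence \<open>v\<close>, into \<open>I\<close>.

  The splitting of \<open>a\<close> is Delorme's theorem. With \<open>H(V) = G(V) + \<Sum>w\<close>, his formula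
  satisfies the recursion \<open>(|V| - 1) H(V) = lcm V + (\<Sum>x\<in>V. H(V - {x}))\<close>
  (\<open>lcm_average_recursion\<close>). By averaging, a monomial of degree above \<open>lcm V + G(V)\<close> remains
  above the corresponding bound for \<open>V - {x}\<close> after some variable \<open>x\<close> is deleted from it, and
  induction on the set of variables applies.

  Delorme's theorem also shows \<open>q + G \<ge> 0\<close>: otherwise the constant monomial would have a
  divisor of degree \<open>q > 0\<close>. So the hypothesis covers all degrees up to \<open>d\<close>, the generators
  lie in spans of monomials of \<open>I\<close>, and \<open>I\<close> is a monomial ideal
  (\<open>monomial_ideal_structure\<close>). This reduces the theorem to the statement on sets of monomials
  described first (\<open>lexsegment_all_degrees\<close>).
\<close>

section \<open>Weighted degrees\<close>

lemma wdeg_eq_sum_superset: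
  assumes "finite A" "Poly_Mapping.keys u \<subseteq> A"
  shows "wdeg w u = (\<Sum>x\<in>A. Poly_Mapping.lookup u x * w x)"
  unfolding wdeg_def using assms
  by (intro sum.mono_neutral_left) (auto simp: in_keys_iff)

lemma wdeg_add: "wdeg w (u + v) = wdeg w u + wdeg w v"
proof -
  let ?A = "Poly_Mapping.keys u \<union> Poly_Mapping.keys v"
  have "Poly_Mapping.keys (u + v) \<subseteq> ?A"
    by (rule Poly_Mapping.keys_add)
  then show ?thesis
    by (simp add: wdeg_eq_sum_superset[of ?A] lookup_add algebra_simps sum.distrib)
qed

lemma wdeg_single: "wdeg w (Poly_Mapping.single x k) = k * w x"
  by (simp add: wdeg_def)

lemma wdeg_zero: "wdeg w 0 = 0"
  by (simp add: wdeg_def)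

lemma monomials_single: "x \<in> V \<Longrightarrow> Poly_Mapping.single x k \<in> monomials V"
  by (simp add: monomials_def)

lemma monomials_add_iff: "u + v \<in> monomials V \<longleftrightarrow> u \<in> monomials V \<and> v \<in> monomials V"
  by (auto simp: monomials_def in_keys_iff subset_iff lookup_add)

lemma monomial_diff_add:
  fixes u v :: "'v monomial"
  assumes "\<And>x. Poly_Mapping.lookup u x \<le> Poly_Mapping.lookup v x"
  shows "v = (v - u) + u"
  by (rule poly_mapping_eqI) (simp add: lookup_add lookup_minus assms)

lemma wdeg_strict_mono:
  assumes le: "\<And>x. Poly_Mapping.lookup u x \<le> Poly_Mapping.lookup v x"
    and less: "Poly_Mapping.lookup u p < Poly_Mapping.lookup v p" and "w p > 0"
  shows "wdeg w u < wdeg w v"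
proof -
  have "p \<in> Poly_Mapping.keys (v - u)"
    using less by (simp add: in_keys_iff lookup_minus)
  then have "wdeg w (v - u) > 0"
    unfolding wdeg_def using \<open>w p > 0\<close>
    by (intro sum_pos2[of _ p]) (auto simp: in_keys_iff)
  then show ?thesis
    using monomial_diff_add[OF le] wdeg_add by (metis less_add_same_cancel2)
qed

section \<open>Delorme's bound\<close>

text \<open>The part of Delorme's invariant that involves least common multiples. It vanishes when
  \<open>V\<close> has one element, because the sum is then empty, so the case distinction in the invariant
  disappears and the recursion below can go down to single variables.\<close>

definition lcm_average :: "'v set \<Rightarrow> ('v \<Rightarrow> nat) \<Rightarrow> real" where
  "lcm_average V w = (\<Sum>\<nu>=2..card V. (\<Sum>J | J \<subseteq> V \<and> card J = \<nu>. real (Lcm (w ` J)))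
     / (real (card V - 1) * real ((card V - 2) choose (\<nu> - 2))))"

lemma delorme_G_eq:
  assumes "card V \<ge> 1"
  shows "delorme_G V w = lcm_average V w - (\<Sum>x\<in>V. real (w x))"
proof (cases "card V = 1")
  case True
  then show ?thesis by (simp add: delorme_G_def lcm_average_def)
next
  case False
  then have "card V - 1 + 1 = card V" "card V - 1 - 1 = card V - 2" using assms by auto
  then show ?thesis using False
    by (simp add: delorme_G_def lcm_average_def sum_distrib_left sum_distrib_right
        divide_inverse Let_def mult_ac del: of_nat_diff)
qed

text \<open>Double counting: a subset of size \<open>\<nu>\<close> avoids exactly \<open>|V| - \<nu>\<close> points of \<open>V\<close>.\<close>

lemma sum_subsets_avoiding_point:
  fixes f :: "'v set \<Rightarrow> real"
  assumes "finite V" "\<nu> \<le> card V"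
  shows "(\<Sum>x\<in>V. \<Sum>J | J \<subseteq> V - {x} \<and> card J = \<nu>. f J)
       = real (card V - \<nu>) * (\<Sum>J | J \<subseteq> V \<and> card J = \<nu>. f J)"
proof -
  let ?P = "{J. J \<subseteq> V \<and> card J = \<nu>}"
  have "(\<Sum>x\<in>V. \<Sum>J | J \<subseteq> V - {x} \<and> card J = \<nu>. f J)
      = (\<Sum>x\<in>V. \<Sum>J | J \<in> ?P \<and> x \<notin> J. f J)"
    by (intro sum.cong refl) auto
  also have "\<dots> = (\<Sum>J\<in>?P. \<Sum>x | x \<in> V \<and> x \<notin> J. f J)"
    using assms(1) by (intro sum.swap_restrict) auto
  also have "\<dots> = (\<Sum>J\<in>?P. real (card V - \<nu>) * f J)"
  proof (intro sum.cong refl)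
    fix J assume "J \<in> ?P"
    then have "card {x. x \<in> V \<and> x \<notin> J} = card V - \<nu>"
      using assms(1) card_Diff_subset[of J V] finite_subset[of J V]
      by (simp add: set_diff_eq)
    then show "(\<Sum>x | x \<in> V \<and> x \<notin> J. f J) = real (card V - \<nu>) * f J" by simp
  qed
  finally show ?thesis by (simp add: sum_distrib_left)
qed

text \<open>This recursion is what makes the binomial weights in Delorme's formula the right ones. By
  double counting, a proper subset of size \<open>\<nu>\<close> contributes to \<open>|V| - \<nu>\<close> of the terms on the
  right, and the absorption identity \<open>(l - \<nu>) C(l - 2, \<nu> - 2) = (l - 2) C(l - 3, \<nu> - 2)\<close> turns
  the coefficients for \<open>l - 1\<close> variables into those for \<open>l\<close> variables; only \<open>V\<close> itself is
  left over.\<close>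

lemma lcm_average_recursion:
  assumes "finite V" "card V \<ge> 2"
  shows "real (card V - 1) * lcm_average V w
       = real (Lcm (w ` V)) + (\<Sum>x\<in>V. lcm_average (V - {x}) w)"
proof -
  define l where "l = card V"
  define S where "S \<nu> = (\<Sum>J | J \<subseteq> V \<and> card J = \<nu>. real (Lcm (w ` J)))" for \<nu>
  define c where "c \<nu> = real ((l - 2) choose (\<nu> - 2))" for \<nu>
  have l: "l \<ge> 2" using assms l_def by simp
  have "{J. J \<subseteq> V \<and> card J = l} = {V}"
    unfolding l_def using assms(1) card_subset_eq by blast
  then have top: "S l = real (Lcm (w ` V))" by (simp add: S_def)
  have cross: "a / b = 1 / e" if "a * e = b" "e \<noteq> 0" "b \<noteq> 0" for a b e :: real
    using that by (auto simp: field_simps)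
  have coeff: "real (l - \<nu>) / (real (l - 2) * real ((l - 3) choose (\<nu> - 2))) = 1 / c \<nu>"
    if "\<nu> \<in> {2..l - 1}" for \<nu>
  proof -
    have "(l - 2 - (\<nu> - 2)) * ((l - 2) choose (\<nu> - 2)) = (l - 2) * ((l - 2 - 1) choose (\<nu> - 2))"
      by (rule binomial_absorb_comp)
    moreover have "l - 2 - (\<nu> - 2) = l - \<nu>" "l - 2 - 1 = l - 3" using that by auto
    ultimately have "real (l - \<nu>) * c \<nu> = real (l - 2) * real ((l - 3) choose (\<nu> - 2))"
      unfolding c_def by (metis of_nat_mult)
    moreover have "l - 2 > 0" "\<nu> - 2 \<le> l - 3" "\<nu> - 2 \<le> l - 2" using that l by auto
    then have "c \<nu> \<noteq> 0" "real (l - 2) * real ((l - 3) choose (\<nu> - 2)) \<noteq> 0"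
      by (auto simp: c_def)
    ultimately show ?thesis by (rule cross)
  qed
  have "(\<Sum>x\<in>V. lcm_average (V - {x}) w)
      = (\<Sum>x\<in>V. \<Sum>\<nu>=2..l-1. (\<Sum>J | J \<subseteq> V - {x} \<and> card J = \<nu>. real (Lcm (w ` J)))
          / (real (l - 2) * real ((l - 3) choose (\<nu> - 2))))"
    using assms by (intro sum.cong refl) (simp add: lcm_average_def l_def numeral_eq_Suc)
  also have "\<dots> = (\<Sum>\<nu>=2..l-1. (\<Sum>x\<in>V. \<Sum>J | J \<subseteq> V - {x} \<and> card J = \<nu>. real (Lcm (w ` J)))
          / (real (l - 2) * real ((l - 3) choose (\<nu> - 2))))"
    by (subst sum.swap) (simp add: sum_divide_distrib)
  also have "\<dots> = (\<Sum>\<nu>=2..l-1. S \<nu> / c \<nu>)"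
  proof (intro sum.cong refl)
    fix \<nu> assume \<nu>: "\<nu> \<in> {2..l - 1}"
    then have "\<nu> \<le> card V" unfolding l_def by auto
    from sum_subsets_avoiding_point[OF assms(1) this, of "\<lambda>J. real (Lcm (w ` J))"]
    have "(\<Sum>x\<in>V. \<Sum>J | J \<subseteq> V - {x} \<and> card J = \<nu>. real (Lcm (w ` J))) = real (l - \<nu>) * S \<nu>"
      by (simp add: S_def l_def)
    then show "(\<Sum>x\<in>V. \<Sum>J | J \<subseteq> V - {x} \<and> card J = \<nu>. real (Lcm (w ` J)))
          / (real (l - 2) * real ((l - 3) choose (\<nu> - 2))) = S \<nu> / c \<nu>"
      using coeff[OF \<nu>] by (metis mult.commute times_divide_eq_right mult_1_right)
  qed
  finally have sub: "(\<Sum>x\<in>V. lcm_average (V - {x}) w) = (\<Sum>\<nu>=2..l-1. S \<nu> / c \<nu>)" .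
  have "lcm_average V w = (\<Sum>\<nu>=2..l. S \<nu> / (real (l - 1) * c \<nu>))"
    by (simp add: lcm_average_def S_def c_def l_def)
  then have "real (l - 1) * lcm_average V w = (\<Sum>\<nu>=2..l. S \<nu> / c \<nu>)"
    using l by (simp add: sum_distrib_left)
  also have "\<dots> = S l / c l + (\<Sum>\<nu>=2..l-1. S \<nu> / c \<nu>)"
    using l by (cases l) (auto simp: add.commute)
  also have "c l = 1" by (simp add: c_def)
  finally show ?thesis using sub top l_def by simp
qed

text \<open>A divisor of degree \<open>m h\<close> is assembled from \<open>h\<close> successive divisors of degree \<open>m\<close>: the
  part left after each extraction is still above the bound for the next one.\<close>

lemma divisor_of_degree_multiple:
  assumes step: "\<And>u. u \<in> monomials V \<Longrightarrow> real (wdeg w u) > real m + B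
      \<Longrightarrow> \<exists>a b. u = a + b \<and> wdeg w a = m"
    and "u \<in> monomials V" "real (wdeg w u) > real (m * h) + B"
  shows "\<exists>a b. u = a + b \<and> wdeg w a = m * h"
  using assms(2,3)
proof (induction h arbitrary: u)
  case 0
  then show ?case by (intro exI[of _ 0] exI[of _ u]) (simp add: wdeg_zero)
next
  case (Suc h)
  have "real m + B \<le> real (m * Suc h) + B" by (simp del: of_nat_mult)
  then obtain a b where ab: "u = a + b" "wdeg w a = m"
    using step[of u] Suc.prems by (metis order_le_less_trans)
  then have "b \<in> monomials V" "real (wdeg w b) > real (m * h) + B"
    using Suc.prems by (auto simp: monomials_add_iff wdeg_add)
  then obtain a' b' where "b = a' + b'" "wdeg w a' = m * h" using Suc.IH by blast
  then show ?case using ab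
    by (intro exI[of _ "a + a'"] exI[of _ b']) (simp add: wdeg_add add.assoc)
qed

text \<open>Delorme's theorem, by induction on the set of variables. The degree \<open>m\<close> ranges over all
  common multiples of the weights, since the induction hypothesis is applied to \<open>V - {x}\<close> with
  the least common multiple of the weights on \<open>V\<close>, which may exceed the one on \<open>V - {x}\<close>.\<close>

lemma divisor_of_common_multiple_degree:
  assumes "finite V" "V \<noteq> {}" "\<And>x. x \<in> V \<Longrightarrow> w x > 0"
    and "Lcm (w ` V) dvd m" "u \<in> monomials V" "real (wdeg w u) > real m + delorme_G V w"
  shows "\<exists>a b. u = a + b \<and> wdeg w a = m"
  using assms
proof (induction "card V" arbitrary: V m u rule: less_induct)
  case less
  show ?case
  proof (cases "card V = 1")
    case True
    then obtain x where V: "V = {x}" by (auto simp: card_1_singleton_iff)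
    \<comment> \<open>Here the bound reads \<open>m - w x\<close>, and all degrees involved are multiples of \<open>w x\<close>.\<close>
    obtain k where k: "m = w x * k" using less.prems(4) V by auto
    have u: "wdeg w u = Poly_Mapping.lookup u x * w x"
      using wdeg_eq_sum_superset[of V u w] less.prems(5) V by (auto simp: monomials_def)
    have "real (w x * k) < real (Poly_Mapping.lookup u x * w x + w x)"
      using less.prems(6) u k by (simp add: V delorme_G_def)
    then have "w x * k < w x * (Poly_Mapping.lookup u x + 1)"
      by (simp only: of_nat_less_iff) (simp add: algebra_simps)
    then have "k < Poly_Mapping.lookup u x + 1" by (simp only: mult_less_cancel1)
    then have "k \<le> Poly_Mapping.lookup u x" by simp
    then have "u = (u - Poly_Mapping.single x k) + Poly_Mapping.single x k"
      by (intro monomial_diff_add) (auto simp: lookup_single when_def)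
    then show ?thesis
      by (intro exI[of _ "Poly_Mapping.single x k"] exI[of _ "u - Poly_Mapping.single x k"])
        (simp add: wdeg_single k add.commute mult.commute)
  next
    case False
    have V: "finite V" "V \<noteq> {}" and pos: "\<And>x. x \<in> V \<Longrightarrow> w x > 0"
      using less.prems by auto
    have "card V \<noteq> 0" using V by simp
    then have card: "card V \<ge> 2" using False by linarith
    define M where "M = Lcm (w ` V)"
    \<comment> \<open>The averaging argument needs the least common multiple itself: summing the failed bounds over
      the deleted variables yields \<open>|V|\<close> copies of \<open>M\<close>, and one of them has to be the term
      \<open>lcm V\<close> of the recursion.\<close>
    have step: "\<exists>a b. v = a + b \<and> wdeg w a = M"
      if v: "v \<in> monomials V" and big: "real (wdeg w v) > real M + delorme_G V w" for v
    proof -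
      define v' where "v' x = v - Poly_Mapping.single x (Poly_Mapping.lookup v x)" for x
      have v_split: "v = v' x + Poly_Mapping.single x (Poly_Mapping.lookup v x)" for x
        unfolding v'_def by (rule monomial_diff_add) (auto simp: lookup_single when_def)
      have v'_mon: "v' x \<in> monomials (V - {x})" for x
        using v by (auto simp: v'_def monomials_def in_keys_iff lookup_minus lookup_single when_def
            split: if_splits)
      have v'_deg: "real (wdeg w (v' x)) = real (wdeg w v) - real (Poly_Mapping.lookup v x * w x)" for x
        using arg_cong[OF v_split[of x], of "wdeg w"] by (simp add: wdeg_add wdeg_single)
      have sub_card: "card (V - {x}) \<ge> 1" if "x \<in> V" for x
        using that card V by simp
      have "\<exists>x\<in>V. real (wdeg w (v' x)) > real M + delorme_G (V - {x}) w"
      proof (rule ccontr)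
        assume "\<not> ?thesis"
        then have le: "real (wdeg w (v' x)) \<le> real M + delorme_G (V - {x}) w" if "x \<in> V" for x
          using that by (meson not_less)
        define W where "W = (\<Sum>x\<in>V. real (w x))"
        have "real (wdeg w v) + W - real (Poly_Mapping.lookup v x * w x) - real (w x)
            \<le> real M + lcm_average (V - {x}) w" if x: "x \<in> V" for x
          using le[OF x] v'_deg[of x] delorme_G_eq[OF sub_card[OF x], of w]
          by (simp add: W_def sum_diff1 V x)
        then have "(\<Sum>x\<in>V. real (wdeg w v) + W - real (Poly_Mapping.lookup v x * w x) - real (w x))
            \<le> (\<Sum>x\<in>V. real M + lcm_average (V - {x}) w)"
          by (rule sum_mono)
        \<comment> \<open>Deleting each variable in turn loses the degree of \<open>v\<close> exactly once in total.\<close>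
        moreover have "(\<Sum>x\<in>V. real (Poly_Mapping.lookup v x * w x)) = real (wdeg w v)"
          using wdeg_eq_sum_superset[of V v w] V v by (simp add: monomials_def)
        moreover have "real (card V - 1) = real (card V) - 1" using card by simp
        ultimately have "real (card V - 1) * (real (wdeg w v) + W)
            \<le> real (card V - 1) * real M + (real M + (\<Sum>x\<in>V. lcm_average (V - {x}) w))"
          by (simp add: sum.distrib sum_subtractf W_def algebra_simps)
        also have "\<dots> = real (card V - 1) * (real M + lcm_average V w)"
          using lcm_average_recursion[OF V(1) card, of w] by (simp add: M_def algebra_simps)
        finally have "real (wdeg w v) + W \<le> real M + lcm_average V w"
          using card by simp
        then show False
          using big delorme_G_eq[of V w] card by (simp add: W_def)
      qed
      then obtain x where x: "x \<in> V" and "real (wdeg w (v' x)) > real M + delorme_G (V - {x}) w"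
        by blast
      moreover have "Lcm (w ` (V - {x})) dvd M"
        unfolding M_def by (intro Lcm_subset image_mono) auto
      moreover have "card (V - {x}) < card V" using V x by (intro psubset_card_mono) auto
      moreover have "V - {x} \<noteq> {}" using sub_card[OF x] by (metis card.empty not_one_le_zero)
      ultimately obtain a b where "v' x = a + b" "wdeg w a = M"
        using less.hyps[of "V - {x}" M "v' x"] V(1) pos v'_mon by auto
      then show ?thesis
        using v_split[of x] by (metis add.assoc)
    qed
    obtain h where h: "m = M * h" using less.prems(4) M_def by auto
    show ?thesis
      unfolding h by (rule divisor_of_degree_multiple[OF step])
        (use less.prems h in auto)
  qed
qed

section \<open>Lexsegments propagate upwards in degree\<close>

text \<open>In multiplicative notation, \<open>v > u a\<close> implies \<open>v \<ge> u x^e\<close> for the last variable \<open>x\<close> of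
  \<open>v\<close>, when all three monomials have the same degree. Suppose \<open>v < u x^e\<close>, with first
  difference at \<open>p\<close>. If \<open>p\<close> precedes \<open>x\<close>, then \<open>v\<close> falls below \<open>u\<close> at \<open>p\<close> after agreeing
  with it, which \<open>v > u a\<close> forbids. Otherwise \<open>v\<close> has no variables after \<open>p\<close>, so it is a
  proper divisor of \<open>u x^e\<close>, which contradicts the equality of degrees.\<close>

lemma add_power_of_last_variable_le:
  fixes u a v :: "'v::linorder monomial"
  assumes less: "u + a < v" and deg: "wdeg w v = wdeg w u + wdeg w a"
    and x: "x = Max (Poly_Mapping.keys v)" and e: "e * w x = wdeg w a"
    and pos: "\<And>y. y \<in> V \<Longrightarrow> w y > 0" and mon: "u \<in> monomials V" "x \<in> V"
  shows "u + Poly_Mapping.single x e \<le> v"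
proof (rule ccontr)
  let ?y = "u + Poly_Mapping.single x e"
  assume "\<not> ?thesis"
  then obtain p where p: "Poly_Mapping.lookup v p < Poly_Mapping.lookup ?y p"
    "\<And>z. z < p \<Longrightarrow> Poly_Mapping.lookup v z = Poly_Mapping.lookup ?y z"
    unfolding not_le monomial_less_iff by auto
  obtain r where r: "Poly_Mapping.lookup (u + a) r < Poly_Mapping.lookup v r"
    "\<And>z. z < r \<Longrightarrow> Poly_Mapping.lookup (u + a) z = Poly_Mapping.lookup v z"
    using less unfolding monomial_less_iff by auto
  show False
  proof (cases "p < x")
    case True
    then have y: "Poly_Mapping.lookup ?y z = Poly_Mapping.lookup u z" if "z \<le> p" for z
      using that by (auto simp: lookup_add lookup_single when_def)
    consider "r < p" | "r = p" | "p < r" by fastforce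
    then show False
    proof cases
      case 1
      then show False using p(2)[of r] r(1) y[of r] by (simp add: lookup_add[of u a])
    next
      case 2
      then show False using p(1) r(1) y[of p] by (simp add: lookup_add[of u a])
    next
      case 3
      then show False using p(1) r(2)[of p] y[of p] by (simp add: lookup_add[of u a])
    qed
  next
    case False
    have "Poly_Mapping.lookup v z \<le> Poly_Mapping.lookup ?y z" for z
    proof (cases "z \<le> p")
      case True
      then show ?thesis using p by (cases "z = p") (auto simp: less_le)
    next
      case False
      then have "x < z" using \<open>\<not> p < x\<close> by simp
      then have "z \<notin> Poly_Mapping.keys v"
        using Max_ge[OF finite_keys, of z v] unfolding x by (meson not_le)
      then show ?thesis by (simp add: in_keys_iff)
    qed
    moreover have "p \<in> V"
      using p(1) mon by (cases "p = x")
        (auto simp: monomials_def lookup_add lookup_single when_def in_keys_iff)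
    ultimately have "wdeg w v < wdeg w ?y"
      by (intro wdeg_strict_mono[OF _ p(1) pos])
    then show False
      using deg e by (simp add: wdeg_add wdeg_single)
  qed
qed

text \<open>The theorem for the set \<open>U\<close> of monomials of a monomial ideal generated in degrees at most
  \<open>d\<close>. In the induction step, the comparison of \<open>v\<close> with \<open>u' x^(e+1)\<close> is divided by \<open>x\<close>, the
  last variable of \<open>v\<close>; positivity of the weight of \<open>x\<close> is what lowers the degree.\<close>

lemma lexsegment_all_degrees:
  fixes U :: "'v::linorder monomial set"
  assumes V: "finite V" "V \<noteq> {}" and pos: "\<And>x. x \<in> V \<Longrightarrow> w x > 0"
    and U: "U \<subseteq> monomials V" "\<And>u v. u \<in> U \<Longrightarrow> v \<in> monomials V \<Longrightarrow> u + v \<in> U"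
    and gen: "\<And>u. u \<in> U \<Longrightarrow> \<exists>g\<in>U. \<exists>m\<in>monomials V. u = g + m \<and> wdeg w g \<le> d"
    and low: "\<And>i. real i \<le> real d + real (Lcm (w ` V)) + delorme_G V w
        \<Longrightarrow> lexsegment V w i {u \<in> U. wdeg w u = i}"
  shows "lexsegment V w i {u \<in> U. wdeg w u = i}"
proof (induction i rule: less_induct)
  case (less i)
  show ?case
  proof (cases "real i \<le> real d + real (Lcm (w ` V)) + delorme_G V w")
    case True
    then show ?thesis by (rule low)
  next
    case False
    define M where "M = Lcm (w ` V)"
    have "0 \<notin> w ` V" using pos by fastforce
    then have "M \<noteq> 0" using V by (simp add: M_def Lcm_0_iff)
    have "v \<in> U" if u: "u \<in> U" "wdeg w u = i" and v: "v \<in> monomials V" "wdeg w v = i"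
      and "u < v" for u v
    proof -
      obtain g m where gm: "g \<in> U" "m \<in> monomials V" "u = g + m" "wdeg w g \<le> d"
        using gen u by blast
      then have "real (wdeg w m) > real M + delorme_G V w"
        using False u by (simp add: wdeg_add M_def)
      then obtain a b where ab: "m = a + b" "wdeg w a = M"
        using divisor_of_common_multiple_degree[of V w M m] V pos gm(2) M_def by auto
      define u' where "u' = g + b"
      have u': "u' \<in> U" "u = u' + a"
        using U(2)[of g b] gm ab by (auto simp: u'_def monomials_add_iff ac_simps)
      have "v \<noteq> 0" using \<open>u < v\<close> by (auto simp: monomial_less_iff)
      define x where "x = Max (Poly_Mapping.keys v)"
      have xv: "x \<in> Poly_Mapping.keys v" unfolding x_def using \<open>v \<noteq> 0\<close> by (intro Max_in) auto
      then have "x \<in> V" using v by (auto simp: monomials_def)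
      then have "w x dvd M" unfolding M_def by (intro dvd_Lcm) auto
      then obtain e' where e': "M = w x * e'" by auto
      then obtain e where e: "M = Suc e * w x"
        using \<open>M \<noteq> 0\<close> by (cases e') auto
      have le: "u' + Poly_Mapping.single x (Suc e) \<le> v"
        by (rule add_power_of_last_variable_le[where a = a and w = w and V = V])
          (use \<open>u < v\<close> u u' v ab e x_def pos U(1) \<open>x \<in> V\<close> in \<open>auto simp: wdeg_add\<close>)
      define y where "y = u' + Poly_Mapping.single x e"
      define v' where "v' = v - Poly_Mapping.single x 1"
      have v': "v = v' + Poly_Mapping.single x 1"
        unfolding v'_def using xv
        by (intro monomial_diff_add) (auto simp: lookup_single when_def in_keys_iff)
      have "Poly_Mapping.single x (Suc e) = Poly_Mapping.single x e + Poly_Mapping.single x 1"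
        by (simp flip: single_add)
      then have y: "u' + Poly_Mapping.single x (Suc e) = y + Poly_Mapping.single x 1"
        by (simp add: y_def add.assoc)
      have "y \<le> v'" using le unfolding y v' by simp
      have "y \<in> U" using u' U(2) \<open>x \<in> V\<close> by (simp add: y_def monomials_single)
      have "wdeg w y = wdeg w v'"
        using u v ab e u' v' by (simp add: y_def wdeg_add wdeg_single)
      moreover have "wdeg w v' < i"
        using v v' pos \<open>x \<in> V\<close> by (metis wdeg_add wdeg_single less_add_same_cancel1 mult_1)
      moreover have "v' \<in> monomials V" using v v' by (metis monomials_add_iff)
      ultimately have "v' \<in> U"
        using less.IH[of "wdeg w v'"] \<open>y \<le> v'\<close> \<open>y \<in> U\<close>
        by (cases "y = v'") (auto simp: lexsegment_def)
      then show ?thesis using v' U(2) \<open>x \<in> V\<close> by (metis monomials_single)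
    qed
    then show ?thesis using U(1) by (auto simp: lexsegment_def)
  qed
qed

section \<open>Ideals and spans described by monomials\<close>

text \<open>A polynomial is the sum of its terms, so closure under addition and membership of all
  terms suffice; this is used below for ideals and for spans.\<close>

lemma poly_sum_closed_induct:
  fixes f :: "('v, 'k::field_char_0) mpoly"
  assumes "P 0" "\<And>f g. P f \<Longrightarrow> P g \<Longrightarrow> P (f + g)"
    and "\<And>u c. u \<in> L \<Longrightarrow> P (Poly_Mapping.single u c)"
    and "Poly_Mapping.keys f \<subseteq> L"
  shows "P f"
proof -
  have "P (\<Sum>u\<in>A. Poly_Mapping.single u (Poly_Mapping.lookup f u))" if "finite A" "A \<subseteq> L" for A
    using that by (induction A rule: finite_induct) (auto intro: assms)
  from this[of "Poly_Mapping.keys f"] assms(4)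
  have "P (\<Sum>u\<in>Poly_Mapping.keys f. Poly_Mapping.single u (Poly_Mapping.lookup f u))" by simp
  also have "(\<Sum>u\<in>Poly_Mapping.keys f. Poly_Mapping.single u (Poly_Mapping.lookup f u)) = f"
    by (rule poly_mapping_eqI)
      (simp add: lookup_sum lookup_single when_def in_keys_iff)
  finally show ?thesis .
qed

lemma K_span_monomials:
  "K_span (poly_of_monomial ` L) = {f :: ('v, 'k::field_char_0) mpoly. Poly_Mapping.keys f \<subseteq> L}"
proof -
  interpret vector_space "scalar_mult :: 'k \<Rightarrow> ('v, 'k) mpoly \<Rightarrow> _"
    by (rule scalar_mult_vector_space)
  let ?F = "{f :: ('v, 'k) mpoly. Poly_Mapping.keys f \<subseteq> L}"
  have "subspace ?F"
    unfolding subspace_def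
  proof (intro conjI ballI allI)
    fix c and f :: "('v, 'k) mpoly" assume "f \<in> ?F"
    moreover have "Poly_Mapping.keys (scalar_mult c f) \<subseteq> Poly_Mapping.keys f"
      using keys_mult[of "Poly_Mapping.single 0 c" f] by (auto simp: scalar_mult_def split: if_splits)
    ultimately show "scalar_mult c f \<in> ?F" by blast
  qed (use Poly_Mapping.keys_add in fastforce)+
  then have "span (poly_of_monomial ` L) \<subseteq> ?F"
    by (intro span_minimal) (auto simp: poly_of_monomial_def)
  moreover have "f \<in> span (poly_of_monomial ` L)" if "f \<in> ?F" for f
  proof (rule poly_sum_closed_induct[of _ L])
    fix u c assume "u \<in> L"
    then have "scalar_mult c (poly_of_monomial u) \<in> span (poly_of_monomial ` L)"
      by (intro span_scale span_base) auto
    then show "Poly_Mapping.single u c \<in> span (poly_of_monomial ` L)"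
      by (simp add: scalar_mult_def poly_of_monomial_def mult_single)
  qed (use that in \<open>auto intro: span_zero span_add\<close>)
  ultimately show ?thesis unfolding K_span_def by blast
qed

lemma ideal_keys_subset:
  assumes U: "U \<subseteq> monomials V" "\<And>u v. u \<in> U \<Longrightarrow> v \<in> monomials V \<Longrightarrow> u + v \<in> U"
  shows "ideal {f :: ('v, 'k::field_char_0) mpoly. Poly_Mapping.keys f \<subseteq> U} (poly_ring V)"
    (is "ideal ?J ?R")
proof -
  interpret cring ?R by (rule poly_ring_cring)
  have carrier: "f \<in> carrier ?R \<longleftrightarrow> Poly_Mapping.keys f \<subseteq> monomials V" for f
    by (simp add: poly_ring_def)
  have uminus: "\<ominus>\<^bsub>?R\<^esub> f = - f" if "f \<in> carrier ?R" for f
    by (rule minus_equality) (use that in \<open>auto simp: poly_ring_def\<close>)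
  show ?thesis
  proof (rule idealI)
    show "ring ?R" by (rule ring_axioms)
    show "subgroup ?J (add_monoid ?R)"
    proof
      show "?J \<subseteq> carrier (add_monoid ?R)" using U(1) by (auto simp: carrier)
      show "f \<otimes>\<^bsub>add_monoid ?R\<^esub> g \<in> ?J" if "f \<in> ?J" "g \<in> ?J" for f g
        using that Poly_Mapping.keys_add[of f g] by (auto simp: poly_ring_def)
      show "\<one>\<^bsub>add_monoid ?R\<^esub> \<in> ?J" by (simp add: poly_ring_def)
      show "inv\<^bsub>add_monoid ?R\<^esub> f \<in> ?J" if "f \<in> ?J" for f
        using that U(1) uminus[of f] unfolding a_inv_def[symmetric] carrier by auto
    qed
    show "g \<otimes>\<^bsub>?R\<^esub> f \<in> ?J" if "f \<in> ?J" "g \<in> carrier ?R" for f g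
      using that keys_mult[of g f] U(2) by (fastforce simp: poly_ring_def add.commute)
    then show "f \<otimes>\<^bsub>?R\<^esub> g \<in> ?J" if "f \<in> ?J" "g \<in> carrier ?R" for f g
      using that by (simp add: poly_ring_def mult.commute)
  qed
qed

lemma ideal_contains_polys_on_monomials:
  fixes f :: "('v, 'k::field_char_0) mpoly"
  assumes I: "ideal I (poly_ring V)" and L: "\<And>u. u \<in> L \<Longrightarrow> poly_of_monomial u \<in> I"
    and "Poly_Mapping.keys f \<subseteq> L"
  shows "f \<in> I"
proof (rule poly_sum_closed_induct[of "\<lambda>f. f \<in> I" L])
  interpret ideal I "poly_ring V" by (rule I)
  show "0 \<in> I" using additive_subgroup.zero_closed[OF is_additive_subgroup] by (simp add: poly_ring_def)
  show "f + g \<in> I" if "f \<in> I" "g \<in> I" for f g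
    using additive_subgroup.a_closed[OF is_additive_subgroup that]
    by (simp add: poly_ring_def)
  show "Poly_Mapping.single u c \<in> I" if "u \<in> L" for u c
  proof -
    have "Poly_Mapping.single 0 c \<in> carrier (poly_ring V)"
      by (simp add: poly_ring_def monomials_def)
    from I_l_closed[OF L[OF that] this] show ?thesis
      by (simp add: poly_ring_def poly_of_monomial_def mult_single)
  qed
qed (use assms in auto)

text \<open>The polynomials supported on monomial multiples of the monomials of \<open>I\<close> of degree at most
  \<open>d\<close> form an ideal \<open>J \<subseteq> I\<close>. Each generator of \<open>I\<close> lies in a graded component spanned by
  such monomials, hence in \<open>J\<close>, so \<open>I = J\<close>. Then \<open>I\<close> is determined by its set \<open>U\<close> of
  monomials, which inherits the bound on the generating degrees.\<close>

lemma monomial_ideal_structure: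
  fixes I :: "('v::linorder, 'k::field_char_0) mpoly set"
  assumes I: "ideal I (poly_ring V)" and gen: "generated_in_degrees_le V w I d"
    and low: "\<And>i. i \<le> d \<Longrightarrow> spanned_by_lexsegment V w I i"
  defines "U \<equiv> {u \<in> monomials V. poly_of_monomial u \<in> I}"
  shows "monomial_ideal V I" "I = {f. Poly_Mapping.keys f \<subseteq> U}"
    "\<And>u v. u \<in> U \<Longrightarrow> v \<in> monomials V \<Longrightarrow> u + v \<in> U"
    "\<And>u. u \<in> U \<Longrightarrow> \<exists>g\<in>U. \<exists>m\<in>monomials V. u = g + m \<and> wdeg w g \<le> d"
proof -
  let ?R = "poly_ring V :: ('v, 'k) mpoly ring"
  interpret R: cring ?R by (rule poly_ring_cring)
  interpret I: ideal I ?R by (rule I)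
  have mult_closed: "u + v \<in> U" if u: "u \<in> U" and v: "v \<in> monomials V" for u v
  proof -
    have "poly_of_monomial v \<in> carrier ?R"
      using v by (simp add: poly_ring_def poly_of_monomial_def)
    from I.I_r_closed[OF _ this, of "poly_of_monomial u"] u v show ?thesis
      by (simp add: U_def poly_ring_def poly_of_monomial_def mult_single monomials_add)
  qed
  define M where "M = {u \<in> U. wdeg w u \<le> d}"
  define N where "N = {g + m | g m. g \<in> M \<and> m \<in> monomials V}"
  let ?J = "{f :: ('v, 'k) mpoly. Poly_Mapping.keys f \<subseteq> N}"
  obtain S where S: "S \<subseteq> carrier ?R" "\<And>f. f \<in> S \<Longrightarrow> \<exists>i\<le>d. homogeneous w i f"
    "I = Idl\<^bsub>?R\<^esub> S"
    using gen unfolding generated_in_degrees_le_def by blast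
  have MN: "M \<subseteq> N"
  proof
    fix u assume "u \<in> M"
    then have "u + 0 \<in> N" unfolding N_def by (fastforce simp: monomials_def)
    then show "u \<in> N" by simp
  qed
  have NU: "N \<subseteq> U" unfolding N_def M_def using mult_closed by auto
  have J: "ideal ?J ?R"
  proof (rule ideal_keys_subset)
    show "N \<subseteq> monomials V" using NU U_def by auto
    show "u + v \<in> N" if uN: "u \<in> N" and v: "v \<in> monomials V" for u v
    proof -
      obtain g m where "u = g + m" "g \<in> M" "m \<in> monomials V" using uN N_def by blast
      moreover from this have "m + v \<in> monomials V" using v monomials_add by blast
      ultimately show ?thesis unfolding N_def by (auto simp: add.assoc)
    qed
  qed
  have "S \<subseteq> ?J"
  proof
    fix f assume "f \<in> S"
    obtain i where i: "i \<le> d" "homogeneous w i f" using S(2) \<open>f \<in> S\<close> by blast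
    obtain L where L: "lexsegment V w i L" "graded_component w I i = K_span (poly_of_monomial ` L)"
      using low[OF i(1)] unfolding spanned_by_lexsegment_def by blast
    then have L_eq: "graded_component w I i = {f. Poly_Mapping.keys f \<subseteq> L}"
      by (simp add: K_span_monomials)
    have "L \<subseteq> M"
    proof
      fix u assume u: "u \<in> L"
      then have "poly_of_monomial u \<in> graded_component w I i"
        unfolding L_eq by (simp add: poly_of_monomial_def)
      then show "u \<in> M"
        using L(1) u i(1) by (auto simp: M_def U_def graded_component_def lexsegment_def)
    qed
    moreover have "f \<in> I" using \<open>f \<in> S\<close> S R.genideal_self by blast
    then have "Poly_Mapping.keys f \<subseteq> L"
      using i(2) L_eq by (auto simp: graded_component_def)
    ultimately show "f \<in> ?J" using MN by auto
  qed
  then have I_sub: "I \<subseteq> ?J" unfolding S(3) by (rule R.genideal_minimal[OF J])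
  have "U \<subseteq> N"
    using I_sub by (auto simp: U_def poly_of_monomial_def)
  with NU have UN: "U = N" by auto
  have U_sub: "?J \<subseteq> I"
    using ideal_contains_polys_on_monomials[OF I, of N] NU by (auto simp: U_def)
  show I_eq: "I = {f. Poly_Mapping.keys f \<subseteq> U}" using I_sub U_sub UN by auto
  have U_carrier: "poly_of_monomial ` U \<subseteq> carrier ?R"
    by (auto simp: U_def poly_ring_def poly_of_monomial_def)
  have "I \<subseteq> Idl\<^bsub>?R\<^esub> (poly_of_monomial ` U)"
    using ideal_contains_polys_on_monomials[OF R.genideal_ideal[OF U_carrier], of U]
      R.genideal_self[OF U_carrier] I_eq by blast
  moreover have "Idl\<^bsub>?R\<^esub> (poly_of_monomial ` U) \<subseteq> I"
    by (rule R.genideal_minimal[OF I]) (auto simp: U_def)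
  ultimately show "monomial_ideal V I"
    unfolding monomial_ideal_def by (intro exI[of _ U]) (auto simp: U_def)
  show "u + v \<in> U" if "u \<in> U" "v \<in> monomials V" for u v using mult_closed that .
  show "\<exists>g\<in>U. \<exists>m\<in>monomials V. u = g + m \<and> wdeg w g \<le> d" if "u \<in> U" for u
  proof -
    obtain g m where "u = g + m" "g \<in> M" "m \<in> monomials V"
      using \<open>U \<subseteq> N\<close> \<open>u \<in> U\<close> unfolding N_def by blast
    then show ?thesis unfolding M_def by blast
  qed
qed

text \<open>Monomials are linearly independent, so the only candidate for the spanning lexsegment is
  the set of all monomials of degree \<open>i\<close> in the ideal.\<close>

lemma spanned_by_lexsegment_iff:
  fixes I :: "('v::linorder, 'k::field_char_0) mpoly set"
  assumes I: "I = {f. Poly_Mapping.keys f \<subseteq> U}"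
  shows "spanned_by_lexsegment V w I i \<longleftrightarrow> lexsegment V w i {u \<in> U. wdeg w u = i}"
proof -
  have "graded_component w I i = {f. Poly_Mapping.keys f \<subseteq> {u \<in> U. wdeg w u = i}}"
    by (auto simp: graded_component_def I homogeneous_def)
  moreover have "L = L'" if "{f :: ('v, 'k) mpoly. Poly_Mapping.keys f \<subseteq> L} = {f. Poly_Mapping.keys f \<subseteq> L'}"
    for L L' :: "'v monomial set"
  proof -
    have "u \<in> L \<longleftrightarrow> u \<in> L'" for u
      using that[unfolded set_eq_iff, rule_format, of "poly_of_monomial u"]
      by (simp add: poly_of_monomial_def)
    then show ?thesis by blast
  qed
  ultimately show ?thesis
    unfolding spanned_by_lexsegment_def K_span_monomials by auto
qed

section \<open>Lexicographic ideals\<close>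

theorem proposition4p9:
  fixes n d :: nat
    and ls q :: "nat \<Rightarrow> nat"
    and I :: "(nat \<times> nat, 'k::field_char_0) mpoly set"
  defines "V \<equiv> grouped_vars n ls"
    and "w \<equiv> grouped_weight q"
  assumes "n \<ge> 1"
    and "\<And>i. i \<in> {1..n} \<Longrightarrow> ls i \<ge> 1"
    and "q 1 > 0"
    and "strict_mono_on {1..n} q"
    and "homogeneous_ideal V w I"
    and "generated_in_degrees_le V w I d"
    and "\<And>i. real i \<le> real d + real (Lcm (q ` {1..n})) + delorme_G V w
           \<Longrightarrow> spanned_by_lexsegment V w I i"
  shows "lexicographic_ideal V w I"
proof -
  have "finite V" unfolding V_def grouped_vars_def by auto
  have image: "w ` V = q ` {1..n}"
  proof
    show "w ` V \<subseteq> q ` {1..n}"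
      by (auto simp: V_def w_def grouped_vars_def grouped_weight_def)
    show "q ` {1..n} \<subseteq> w ` V"
    proof
      fix y assume "y \<in> q ` {1..n}"
      then obtain i where i: "i \<in> {1..n}" "y = q i" by blast
      then have "(i, 1) \<in> V" "w (i, 1) = y"
        using assms(4)[OF i(1)] by (auto simp: V_def w_def grouped_vars_def grouped_weight_def)
      then show "y \<in> w ` V" by blast
    qed
  qed
  then have "V \<noteq> {}" using \<open>n \<ge> 1\<close> by auto
  have pos: "w x > 0" if "x \<in> V" for x
  proof -
    have "w x \<in> q ` {1..n}" using imageI[OF that, of w] unfolding image .
    then obtain i where i: "i \<in> {1..n}" "w x = q i" by blast
    then have "q 1 \<le> q i"
      using strict_mono_onD[OF assms(6), of 1 i] by (cases "i = 1") auto
    then show ?thesis using i assms(5) by simp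
  qed
  define M where "M = Lcm (w ` V)"
  have "0 \<notin> w ` V" using pos by fastforce
  then have "M \<noteq> 0" using \<open>finite V\<close> by (simp add: M_def Lcm_0_iff)
  \<comment> \<open>Otherwise Delorme's theorem applies to the constant monomial, of degree 0.\<close>
  have "real M + delorme_G V w \<ge> 0"
  proof (rule ccontr)
    assume "\<not> ?thesis"
    then obtain a b :: "(nat \<times> nat) monomial" where "0 = a + b" "wdeg w a = M"
      using divisor_of_common_multiple_degree[of V w M 0] \<open>finite V\<close> \<open>V \<noteq> {}\<close> pos
      by (auto simp: M_def wdeg_zero monomials_def)
    then show False
      using \<open>M \<noteq> 0\<close> wdeg_add[of w a b] by (simp add: wdeg_zero)
  qed
  then have low: "spanned_by_lexsegment V w I i" if "i \<le> d" for i
    using assms(9)[of i] that by (simp add: M_def image)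
  have I: "ideal I (poly_ring V)"
    using assms(7) by (simp add: homogeneous_ideal_def)
  define U where "U = {u \<in> monomials V. poly_of_monomial u \<in> I}"
  note struct = monomial_ideal_structure[OF I assms(8) low, folded U_def]
  have "lexsegment V w i {u \<in> U. wdeg w u = i}" for i
  proof (rule lexsegment_all_degrees[where d = d])
    show "lexsegment V w i {u \<in> U. wdeg w u = i}"
      if "real i \<le> real d + real (Lcm (w ` V)) + delorme_G V w" for i
      using assms(9)[of i] that image spanned_by_lexsegment_iff[OF struct(2), of V w i] by simp
    show "U \<subseteq> monomials V" by (auto simp: U_def)
  qed (use \<open>finite V\<close> \<open>V \<noteq> {}\<close> pos struct(3,4) in blast)+
  then show ?thesis
    using assms(7) struct(1) spanned_by_lexsegment_iff[OF struct(2)]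
    by (simp add: lexicographic_ideal_def)
qed

end
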